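(* Let $K>0$, $\gamma>1$, and let $T\in(0,\infty]$. Let $(u(x,t),\tau(x,t))$, $\tau>0$, be a $C^1$ solution of the isentropic Euler equations ($p$-system) $$\tau_t-u_x=0,\qquad u_t+p_x=0,\qquad p=K\tau^{-\gamma},$$ in the region $(x,t)\in\mathbb R\times[0,T)$. Put $\rho=1/\tau$, $\eta=\frac{2\sqrt{K\gamma}}{\gamma-1}\tau^{-\frac{\gamma-1}{2}}$, $\alpha=u_x+\eta_x$ and $\beta=u_x-\eta_x$. Assume that $u(x,0)$, $\tau(x,0)>0$, $\rho(x,0)=1/\tau(x,0)$, $\alpha(x,0)$ and $\beta(x,0)$ are all uniformly bounded in $x\in\mathbb R$. Let $M$ be a constant with $$\max_{x\in\mathbb R}\big\{\alpha(x,0),\beta(x,0)\big\}<M.$$ Then $$\max_{(x,t)\in\mathbb R\times[0,T)}\big\{\alpha(x,t),\beta(x,t)\big\}<M,$$ $$\max_{(x,t)\in\mathbb R\times[0,T)}\{\tau_t\}=\max_{(x,t)\in\mathbb R\times[0,T)}\{u_x\}<M,$$ and there exist positive constants $M_1$ and $M_2$ independent of $T$ such that, for all $t\in[0,T)$, $$\min_{x}\rho(x,t)\ge\frac{M_1}{M_2+t}.$$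
   Context: The equations are in Lagrangian coordinates: $x\in\mathbb R$ is the spatial coordinate, $t\ge 0$ is time, $u$ is the velocity, $\rho$ the density, $\tau=1/\rho$ the specific volume, $p$ the pressure. There is no restriction on the size of the data. Maxima and minima over non-compact sets are understood as suprema and infima; $\max\{\alpha,\beta\}$ over a set means the supremum over the set of both functions. *)

theory Defs
  imports "HOL-Analysis.Analysis"
begin

text \<open>
  A field \<open>f\<close> is a curried function \<open>f x t\<close> of space and time. Values at times outside
  the half-open interval [0,T) are never used.
\<close>

definition strip :: "ereal \<Rightarrow> (real \<times> real) set" where
  "strip T = {(x, t). 0 \<le> t \<and> ereal t < T}"

definition dx :: "(real \<Rightarrow> real \<Rightarrow> real) \<Rightarrow> real \<Rightarrow> real \<Rightarrow> real" where
  "dx f x t = deriv (\<lambda>y. f y t) x"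

text \<open>
  The time derivative is taken within \<open>{0..}\<close>: it is the ordinary one for \<open>t > 0\<close> and the
  right-hand one at \<open>t = 0\<close>.
\<close>

definition dt :: "(real \<Rightarrow> real \<Rightarrow> real) \<Rightarrow> real \<Rightarrow> real \<Rightarrow> real" where
  "dt f x t = vector_derivative (\<lambda>s. f x s) (at t within {0..})"

definition C1_on_strip :: "ereal \<Rightarrow> (real \<Rightarrow> real \<Rightarrow> real) \<Rightarrow> bool" where
  "C1_on_strip T f \<longleftrightarrow>
     (\<forall>(x, t) \<in> strip T. (\<lambda>y. f y t) differentiable (at x) \<and>
                        (\<lambda>s. f x s) differentiable (at t within {0..})) \<and>
     continuous_on (strip T) (\<lambda>(x, t). f x t) \<and>
     continuous_on (strip T) (\<lambda>(x, t). dx f x t) \<and>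
     continuous_on (strip T) (\<lambda>(x, t). dt f x t)"

definition pressure :: "real \<Rightarrow> real \<Rightarrow> (real \<Rightarrow> real \<Rightarrow> real) \<Rightarrow> real \<Rightarrow> real \<Rightarrow> real" where
  "pressure K \<gamma> \<tau> x t = K * \<tau> x t powr (- \<gamma>)"

definition rho :: "(real \<Rightarrow> real \<Rightarrow> real) \<Rightarrow> real \<Rightarrow> real \<Rightarrow> real" where
  "rho \<tau> x t = 1 / \<tau> x t"

definition eta :: "real \<Rightarrow> real \<Rightarrow> (real \<Rightarrow> real \<Rightarrow> real) \<Rightarrow> real \<Rightarrow> real \<Rightarrow> real" where
  "eta K \<gamma> \<tau> x t = 2 * sqrt (K * \<gamma>) / (\<gamma> - 1) * \<tau> x t powr (- ((\<gamma> - 1) / 2))"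

definition alpha ::
  "real \<Rightarrow> real \<Rightarrow> (real \<Rightarrow> real \<Rightarrow> real) \<Rightarrow> (real \<Rightarrow> real \<Rightarrow> real) \<Rightarrow> real \<Rightarrow> real \<Rightarrow> real" where
  "alpha K \<gamma> u \<tau> x t = dx u x t + dx (eta K \<gamma> \<tau>) x t"

definition beta ::
  "real \<Rightarrow> real \<Rightarrow> (real \<Rightarrow> real \<Rightarrow> real) \<Rightarrow> (real \<Rightarrow> real \<Rightarrow> real) \<Rightarrow> real \<Rightarrow> real \<Rightarrow> real" where
  "beta K \<gamma> u \<tau> x t = dx u x t - dx (eta K \<gamma> \<tau>) x t"

definition p_system_C1_solution ::
  "real \<Rightarrow> real \<Rightarrow> ereal \<Rightarrow> (real \<Rightarrow> real \<Rightarrow> real) \<Rightarrow> (real \<Rightarrow> real \<Rightarrow> real) \<Rightarrow> bool" where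
  "p_system_C1_solution K \<gamma> T u \<tau> \<longleftrightarrow>
     C1_on_strip T u \<and> C1_on_strip T \<tau> \<and>
     (\<forall>(x, t) \<in> strip T. \<tau> x t > 0 \<and>
        dt \<tau> x t - dx u x t = 0 \<and>
        dt u x t + dx (pressure K \<gamma> \<tau>) x t = 0)"

end

theory Submission
  imports Defs
begin

text \<open>
  Write \<open>c = sqrt (K \<gamma>) \<tau> powr (- (\<gamma> + 1) / 2)\<close> for the sound speed. The Riemann invariants
  \<open>u + \<eta>\<close> and \<open>u - \<eta>\<close> are constant along the characteristics \<open>dx/dt = c\<close> and \<open>dx/dt = - c\<close>
  respectively, and \<open>\<alpha>\<close>, \<open>\<beta>\<close> are their space derivatives. For smooth solutions \<open>\<alpha>\<close> and \<open>\<beta>\<close>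
  satisfy Riccati equations, \<open>\<alpha>_t + c \<alpha>_x = k \<alpha> (\<beta> - \<alpha>)\<close> and symmetrically for \<open>\<beta>\<close>, with \<open>k > 0\<close>,
  so whichever of the two is the larger cannot grow while it is nonnegative. For a \<open>C\<^sup>1\<close> solution
  \<open>\<alpha>\<close> and \<open>\<beta>\<close> are merely continuous, and the argument is run on difference quotients: the condition
  preserved in time is that both invariants \<open>w\<close> satisfy \<open>w(y,t) - w(x,t) \<le> N (y - x)\<close> for
  \<open>x \<le> y\<close>. Suppose that this first fails for \<open>w = u + \<eta>\<close> at a pair \<open>x < y\<close>. There \<open>u + \<eta>\<close> has the
  larger increment of the two invariants, hence \<open>\<eta>(x) \<le> \<eta>(y)\<close> and \<open>c(x) \<le> c(y)\<close>: followed
  backwards along the characteristics, the two points do not move apart, while the increment of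
  \<open>u + \<eta>\<close> stays the same. So the condition failed earlier, a contradiction. For \<open>u - \<eta>\<close> the order
  of the speeds and the direction of the characteristics are both reversed, with the same conclusion. This is \<open>one_sided_lipschitz_preserved\<close>; it uses no
  characteristic curves, only derivatives in characteristic directions, because a first failure
  time exists by compactness (\<open>negative_if_no_first_zero\<close>).

  Compactness requires a bounded domain which can be followed backwards along the characteristics, that
  is, a trapezoid whose sides have slope at least \<open>c\<close>. No bound on \<open>c\<close> for positive times is given.
  But \<open>c\<close> is an increasing function of \<open>\<eta>\<close>, and the trapezoid may be fixed beforehand with the
  slope that belongs to a bound slightly larger than the initial one of the invariants; up to the
  first time at which the invariants exceed that bound they are transported with speed at most
  that slope, so this time never comes (\<open>invariants_bounded\<close>).

  The theorem then follows. Since \<open>u\<close> is initially bounded, \<open>\<alpha>\<close> and \<open>\<beta>\<close> cannot both stay below a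
  negative number, so there is \<open>N\<close> with \<open>0 \<le> N < M\<close> that still bounds both initially, and
  therefore always. Hence \<open>\<tau>_t = u_x = (\<alpha> + \<beta>) / 2 \<le> N\<close>, and \<open>\<tau>\<close> grows at most linearly, which is
  the lower bound on the density.
\<close>

section \<open>First zeros and one-sided derivatives\<close>

text \<open>
  A set that is closed under going back in time (for fixed \<open>z\<close>) lets the intermediate value theorem
  produce a zero no later than any point where \<open>G\<close> is nonnegative, so only points with
  \<open>G = 0\<close> need to be traced further back. This is what makes a bound on the solution available at
  the point where the argument is applied.
\<close>

lemma negative_if_no_first_zero:
  fixes G :: "'a::metric_space \<times> real \<Rightarrow> real"
  assumes "compact D" and cont: "continuous_on D G"
    and nonneg: "\<And>z t. (z, t) \<in> D \<Longrightarrow> 0 \<le> t"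
    and down: "\<And>z t s. (z, t) \<in> D \<Longrightarrow> 0 \<le> s \<Longrightarrow> s \<le> t \<Longrightarrow> (z, s) \<in> D"
    and init: "\<And>z. (z, 0) \<in> D \<Longrightarrow> G (z, 0) < 0"
    and earlier: "\<And>z t. (z, t) \<in> D \<Longrightarrow> 0 < t \<Longrightarrow> G (z, t) = 0 \<Longrightarrow>
                 \<exists>z' t'. (z', t') \<in> D \<and> t' < t \<and> 0 \<le> G (z', t')"
    and "(z, t) \<in> D"
  shows "G (z, t) < 0"
proof (rule ccontr)
  define Z where "Z = {p \<in> D. G p = 0}"
  have zero_below: "\<exists>s\<le>t. (z, s) \<in> Z" if zt: "(z, t) \<in> D" "0 \<le> G (z, t)" for z t
  proof -
    have t: "0 \<le> t" using nonneg zt by blast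
    have sub: "Pair z ` {0..t} \<subseteq> D" using down zt by force
    have "continuous_on {0..t} (\<lambda>s. G (z, s))"
      by (rule continuous_on_compose2[OF cont _ sub]) (intro continuous_intros)
    moreover have "G (z, 0) \<le> 0" using init down[OF zt(1)] t by (meson less_imp_le order_refl)
    ultimately obtain s where "0 \<le> s" "s \<le> t" "G (z, s) = 0"
      using IVT'[of "\<lambda>s. G (z, s)" 0 0 t] zt t by auto
    moreover have "(z, s) \<in> D" using sub \<open>0 \<le> s\<close> \<open>s \<le> t\<close> by auto
    ultimately show ?thesis by (auto simp: Z_def)
  qed
  assume "\<not> G (z, t) < 0"
  then have "Z \<noteq> {}" using zero_below[of z t] assms(7) by fastforce
  moreover have "compact Z"
  proof -
    have "closedin (top_of_set D) {p \<in> D. G p = 0}"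
      by (rule continuous_closedin_preimage_constant[OF cont])
    then show ?thesis unfolding Z_def using \<open>compact D\<close> closedin_compact by blast
  qed
  ultimately obtain p where p: "p \<in> Z" "\<And>q. q \<in> Z \<Longrightarrow> snd p \<le> snd q"
    using continuous_attains_inf[of Z snd] continuous_on_snd[OF continuous_on_id] by blast
  obtain z0 t0 where p_eq: "p = (z0, t0)" by fastforce
  then have D0: "(z0, t0) \<in> D" "G (z0, t0) = 0" using p by (auto simp: Z_def)
  then have "0 < t0" using nonneg init by (metis less_eq_real_def less_irrefl)
  then obtain z' t' where "(z', t') \<in> D" "t' < t0" "0 \<le> G (z', t')" using earlier D0 by blast
  then show False using zero_below[of z' t'] p(2) p_eq by fastforce
qed

lemma increases_backwards:
  fixes f :: "real \<Rightarrow> real"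
  assumes "(f has_real_derivative l) (at 0)" "0 < l" "f 0 = 0"
  shows "eventually (\<lambda>h. 0 \<le> f h) (at_right 0)"
proof -
  obtain d where d: "0 < d" "\<And>h. 0 < h \<Longrightarrow> h < d \<Longrightarrow> f 0 < f (0 + h)"
    using DERIV_pos_inc_right[OF assms(1,2)] by blast
  show ?thesis
    unfolding eventually_at_right_field using d assms(3) 
    by (metis add_0 less_imp_le)
qed

text \<open>
  Continuity of the partial derivatives makes a \<open>C\<^sup>1\<close> field totally differentiable, hence
  differentiable in the characteristic directions; times are taken positive since the time derivative is
  one-sided at \<open>0\<close>.
\<close>

lemma C1_on_strip_directional_derivative:
  assumes f: "C1_on_strip T f" and xt: "(x, t) \<in> strip T" "0 < t"
  shows "((\<lambda>h. f (x + h * a) (t - h)) has_real_derivative (a * dx f x t - dt f x t)) (at 0)"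
proof -
  define X where "X = {s::real. 0 < s \<and> ereal s < T}"
  have X_eq: "X = {0<..} \<inter> (\<lambda>s. ereal s) -` {..<T}" by (auto simp: X_def)
  have "open X" unfolding X_eq
    by (intro open_Int open_greaterThan open_vimage open_lessThan continuous_intros)
  have X_strip: "(y, s) \<in> strip T" if "s \<in> X" for y s
    using that by (auto simp: X_def strip_def)
  have tX: "t \<in> X" using xt by (auto simp: X_def strip_def)
  have time: "((\<lambda>s. f x s) has_derivative (\<lambda>h. h * dt f x t)) (at t within X)"
  proof -
    have "(\<lambda>s. f x s) differentiable (at t within {0..})"
      using f xt by (auto simp: C1_on_strip_def)
    then have "((\<lambda>s. f x s) has_vector_derivative dt f x t) (at t within {0..})"
      unfolding dt_def by (simp add: vector_derivative_works)
    then have "((\<lambda>s. f x s) has_vector_derivative dt f x t) (at t within X)"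
      by (rule has_vector_derivative_within_subset) (auto simp: X_def)
    then show ?thesis by (simp add: has_vector_derivative_def)
  qed
  have space: "((\<lambda>y. f y s) has_derivative blinfun_apply (dx f y s *\<^sub>R id_blinfun)) (at y within UNIV)"
    if "s \<in> X" for s y
  proof -
    have "(\<lambda>y. f y s) differentiable (at y)"
      using f X_strip[OF that] by (auto simp: C1_on_strip_def)
    then have "((\<lambda>y. f y s) has_real_derivative dx f y s) (at y)"
      unfolding dx_def by (metis DERIV_imp_deriv real_differentiable_def)
    moreover have "blinfun_apply (dx f y s *\<^sub>R id_blinfun) = (*) (dx f y s)"
      by (auto simp: fun_eq_iff blinfun.scaleR_left)
    ultimately show ?thesis by (simp add: has_field_derivative_def)
  qed
  have cont: "continuous (at (t, x) within X \<times> UNIV) (\<lambda>(s, y). dx f y s *\<^sub>R (id_blinfun :: real \<Rightarrow>\<^sub>L real))"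
  proof -
    have "continuous_on (strip T) (\<lambda>(x, t). dx f x t)" using f by (simp add: C1_on_strip_def)
    then have "continuous_on (X \<times> UNIV) (\<lambda>q. (\<lambda>(x, t). dx f x t) (snd q, fst q))"
      by (rule continuous_on_compose2) (use X_strip in \<open>auto intro!: continuous_intros\<close>)
    then have "continuous_on (X \<times> UNIV) (\<lambda>q. dx f (snd q) (fst q) *\<^sub>R (id_blinfun :: real \<Rightarrow>\<^sub>L real))"
      by (intro continuous_intros) simp
    then show ?thesis using tX by (simp add: continuous_on_eq_continuous_within case_prod_unfold)
  qed
  have "((\<lambda>(s, y). f y s) has_derivative
      (\<lambda>(k, h). k * dt f x t + blinfun_apply (dx f x t *\<^sub>R id_blinfun) h)) (at (t, x) within X \<times> UNIV)"
    by (rule has_derivative_partialsI[where f="\<lambda>s y. f y s" and fy="\<lambda>s y. dx f y s *\<^sub>R id_blinfun"])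
      (use time space cont in auto)
  then have main: "((\<lambda>(s, y). f y s) has_derivative (\<lambda>(k, h). k * dt f x t + dx f x t * h)) (at (t, x))"
    using at_within_open[of "(t, x)" "X \<times> UNIV"] tX \<open>open X\<close>
    by (simp add: open_Times blinfun.scaleR_left)
  have path: "((\<lambda>h. (t - h, x + h * a)) has_derivative (\<lambda>h. (- h, h * a))) (at 0)"
    by (auto intro!: derivative_eq_intros)
  have "((\<lambda>h. (\<lambda>(s, y). f y s) (t - h, x + h * a)) has_derivative
      (\<lambda>h. (\<lambda>(k, h). k * dt f x t + dx f x t * h) (- h, h * a))) (at 0)"
    by (rule has_derivative_compose[OF path]) (use main in simp)
  moreover have "(\<lambda>h. (\<lambda>(k, h). k * dt f x t + dx f x t * h) (- h, h * a)) = (*) (a * dx f x t - dt f x t)"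
    by (auto simp: fun_eq_iff algebra_simps)
  ultimately show ?thesis by (simp add: has_field_derivative_def)
qed


lemma compact_trapezoid:
  fixes R C t1 :: real
  shows "compact {(x, t). 0 \<le> t \<and> t \<le> t1 \<and> \<bar>x\<bar> \<le> R + C * (t1 - t)}"
proof -
  let ?D = "{(x, t). 0 \<le> t \<and> t \<le> t1 \<and> \<bar>x\<bar> \<le> R + C * (t1 - t)}"
  define L where "L = R + \<bar>C\<bar> * t1"
  have "x \<in> {-L..L}" if "(x, t) \<in> ?D" for x t
  proof -
    have "C * (t1 - t) \<le> \<bar>C\<bar> * (t1 - t)" using that by (intro mult_right_mono) auto
    also have "\<dots> \<le> \<bar>C\<bar> * t1" using that by (intro mult_left_mono) auto
    finally have "C * (t1 - t) \<le> \<bar>C\<bar> * t1" .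
    then show ?thesis using that by (auto simp: L_def)
  qed
  then have "?D \<subseteq> {-L..L} \<times> {0..t1}" by auto
  moreover have "closed {p. 0 \<le> snd p \<and> snd p \<le> t1 \<and> \<bar>fst p\<bar> \<le> R + C * (t1 - snd p)}"
    by (intro closed_Collect_conj closed_Collect_le continuous_intros)
  then have "closed ?D" by (simp add: case_prod_unfold)
  moreover have "compact ({-L..L} \<times> {0..t1})" by (intro compact_Times compact_Icc)
  ultimately show ?thesis
    using compact_Int_closed[of "{-L..L} \<times> {0..t1}" ?D] by (simp only: inf.absorb2)
qed

lemma lipschitz_if_derivative_le:
  assumes "\<And>x. (f has_real_derivative f' x) (at x)" "\<And>x. f' x \<le> N" "x \<le> y"
  shows "f y - f x \<le> N * (y - x)"
proof -
  have "N * x - f x \<le> N * y - f y"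
  proof (rule DERIV_nonneg_imp_nondecreasing[OF assms(3)])
    fix z
    have "((\<lambda>z. N * z - f z) has_real_derivative N - f' z) (at z)"
      by (auto intro!: derivative_eq_intros assms(1))
    then show "\<exists>d. ((\<lambda>z. N * z - f z) has_real_derivative d) (at z) \<and> 0 \<le> d"
      using assms(2)[of z] by auto
  qed
  then show ?thesis by (simp add: algebra_simps)
qed

lemma derivative_le_if_lipschitz:
  assumes "(f has_real_derivative d) (at x)" "\<And>x y. x \<le> y \<Longrightarrow> f y - f x \<le> N * (y - x)"
  shows "d \<le> N"
proof -
  have "mono_on UNIV (\<lambda>z. N * z - f z)"
    using assms(2) by (force intro!: mono_onI simp: algebra_simps)
  moreover have "((\<lambda>z. N * z - f z) has_real_derivative N - d) (at x)"
    by (auto intro!: derivative_eq_intros assms(1))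
  ultimately have "0 \<le> N - d" by (rule mono_on_imp_deriv_nonneg) simp
  then show ?thesis by simp
qed

section \<open>Sound speed and Riemann invariants\<close>

locale p_system =
  fixes K \<gamma> :: real and T :: ereal and u \<tau> :: "real \<Rightarrow> real \<Rightarrow> real"
  assumes K: "0 < K" and gamma: "1 < \<gamma>" and sol: "p_system_C1_solution K \<gamma> T u \<tau>"
begin

abbreviation "\<eta> \<equiv> eta K \<gamma> \<tau>"

text \<open>
  The Riemann invariants, named after the family of characteristics along which they are constant.
\<close>

definition "fwd_inv x t = u x t + \<eta> x t"
definition "bwd_inv x t = u x t - \<eta> x t"

text \<open>
  The sound speed as a function of \<open>\<eta>\<close> instead of \<open>\<tau>\<close>; lemma \<open>speed_eta\<close> recovers the usual formula.
  Of the pressure law, only the monotonicity and the sign of this function enter the comparison arguments.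
\<close>

definition "speed e = sqrt (K * \<gamma>) * (e * (\<gamma> - 1) / (2 * sqrt (K * \<gamma>))) powr ((\<gamma> + 1) / (\<gamma> - 1))"

abbreviation "c x t \<equiv> speed (\<eta> x t)"

lemma sound_factor_pos: "0 < sqrt (K * \<gamma>)" using K gamma by simp

lemma u_C1: "C1_on_strip T u" and tau_C1: "C1_on_strip T \<tau>"
  using sol by (auto simp: p_system_C1_solution_def)

lemma tau_pos: "(x, t) \<in> strip T \<Longrightarrow> 0 < \<tau> x t"
  and dt_tau: "(x, t) \<in> strip T \<Longrightarrow> dt \<tau> x t = dx u x t"
  and dt_u: "(x, t) \<in> strip T \<Longrightarrow> dt u x t = - dx (pressure K \<gamma> \<tau>) x t"
  using sol by (auto simp: p_system_C1_solution_def)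

lemma eta_nonneg: "0 \<le> \<eta> x t"
  using sound_factor_pos gamma by (simp add: eta_def)

lemma speed_mono: "0 \<le> e \<Longrightarrow> e \<le> e' \<Longrightarrow> speed e \<le> speed e'"
  unfolding speed_def using sound_factor_pos gamma
  by (intro mult_left_mono powr_mono2 divide_right_mono mult_right_mono) auto

lemma speed_nonneg: "0 \<le> speed e"
  using sound_factor_pos by (simp add: speed_def)

lemma speed_eta:
  assumes "(x, t) \<in> strip T"
  shows "c x t = sqrt (K * \<gamma>) * \<tau> x t powr (- ((\<gamma> + 1) / 2))"
proof -
  have "2 * q / (\<gamma> - 1) * v * (\<gamma> - 1) / (2 * q) = v" if "0 < q" for q v :: real
    using that gamma by (simp add: field_simps)
  from this[OF sound_factor_pos]
  have "\<eta> x t * (\<gamma> - 1) / (2 * sqrt (K * \<gamma>)) = \<tau> x t powr (- ((\<gamma> - 1) / 2))"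
    unfolding eta_def .
  moreover have "- ((\<gamma> - 1) / 2) * ((\<gamma> + 1) / (\<gamma> - 1)) = - ((\<gamma> + 1) / 2)"
    using gamma by (simp add: field_simps)
  ultimately show ?thesis by (simp only: speed_def powr_powr)
qed

lemma speed_squared:
  assumes "(x, t) \<in> strip T"
  shows "c x t * c x t = K * \<gamma> * \<tau> x t powr (- \<gamma> - 1)"
proof -
  have "c x t * c x t = (sqrt (K * \<gamma>) * sqrt (K * \<gamma>)) *
      (\<tau> x t powr (- ((\<gamma> + 1) / 2)) * \<tau> x t powr (- ((\<gamma> + 1) / 2)))"
    by (simp add: speed_eta[OF assms])
  also have "\<dots> = K * \<gamma> * \<tau> x t powr (- ((\<gamma> + 1) / 2) + - ((\<gamma> + 1) / 2))"
    using K gamma by (simp only: powr_add) simp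
  also have "- ((\<gamma> + 1) / 2) + - ((\<gamma> + 1) / 2) = - \<gamma> - 1" by (simp add: field_simps)
  finally show ?thesis .
qed

lemma space_derivatives:
  assumes "(x, t) \<in> strip T"
  shows "((\<lambda>y. u y t) has_real_derivative dx u x t) (at x)"
    and "((\<lambda>y. \<tau> y t) has_real_derivative dx \<tau> x t) (at x)"
proof -
  have *: "((\<lambda>y. f y t) has_real_derivative dx f x t) (at x)" if "C1_on_strip T f" for f
  proof -
    have "(\<lambda>y. f y t) differentiable (at x)"
      using that assms by (auto simp: C1_on_strip_def)
    then show ?thesis unfolding dx_def by (metis DERIV_imp_deriv real_differentiable_def)
  qed
  show "((\<lambda>y. u y t) has_real_derivative dx u x t) (at x)" using * u_C1 .
  show "((\<lambda>y. \<tau> y t) has_real_derivative dx \<tau> x t) (at x)" using * tau_C1 .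
qed

text \<open>
  \<open>d\<eta>/d\<tau> = - c\<close>. The chain rule is needed along arbitrary lines through \<open>(x, t)\<close>: horizontally for
  \<open>\<alpha>\<close> and \<open>\<beta>\<close>, and in characteristic directions for the transport equations.
\<close>

lemma DERIV_eta:
  assumes xt: "(x, t) \<in> strip T" and f: "(f has_real_derivative f') (at z)" and fz: "f z = \<tau> x t"
  shows "((\<lambda>y. 2 * sqrt (K * \<gamma>) / (\<gamma> - 1) * f y powr (- ((\<gamma> - 1) / 2)))
          has_real_derivative - c x t * f') (at z)"
proof -
  have "((\<lambda>y. f y powr (- ((\<gamma> - 1) / 2))) has_real_derivative
      (- ((\<gamma> - 1) / 2)) * f z powr (- ((\<gamma> - 1) / 2) - of_nat 1) * f') (at z)"
    using has_real_derivative_powr[of "f z" "- ((\<gamma> - 1) / 2)"] tau_pos[OF xt] fz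
    by (intro DERIV_chain2[OF _ f]) simp
  then have "((\<lambda>y. 2 * sqrt (K * \<gamma>) / (\<gamma> - 1) * f y powr (- ((\<gamma> - 1) / 2))) has_real_derivative
      2 * sqrt (K * \<gamma>) / (\<gamma> - 1) * ((- ((\<gamma> - 1) / 2)) * f z powr (- ((\<gamma> - 1) / 2) - of_nat 1) * f')) (at z)"
    by (rule DERIV_cmult)
  moreover have "2 * q / (\<gamma> - 1) * ((- ((\<gamma> - 1) / 2)) * v * f') = - (q * v) * f'" for q v :: real
    using gamma by (simp add: field_simps)
  moreover have "- ((\<gamma> - 1) / 2) - of_nat 1 = - ((\<gamma> + 1) / 2)" by (simp add: field_simps)
  ultimately show ?thesis unfolding speed_eta[OF xt] fz by (simp only:)
qed

lemma eta_space_derivative: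
  assumes xt: "(x, t) \<in> strip T"
  shows "((\<lambda>y. \<eta> y t) has_real_derivative - c x t * dx \<tau> x t) (at x)"
proof -
  have "(\<lambda>y. \<eta> y t) = (\<lambda>y. 2 * sqrt (K * \<gamma>) / (\<gamma> - 1) * \<tau> y t powr (- ((\<gamma> - 1) / 2)))"
    by (simp add: eta_def fun_eq_iff)
  then show ?thesis using DERIV_eta[OF xt space_derivatives(2)[OF xt] refl] by (simp only:)
qed

lemma momentum:
  assumes xt: "(x, t) \<in> strip T"
  shows "dt u x t = c x t * c x t * dx \<tau> x t"
proof -
  have "((\<lambda>y. \<tau> y t powr (- \<gamma>)) has_real_derivative
      (- \<gamma>) * \<tau> x t powr (- \<gamma> - of_nat 1) * dx \<tau> x t) (at x)"
    using has_real_derivative_powr[of "\<tau> x t" "- \<gamma>"] tau_pos[OF xt]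
    by (intro DERIV_chain2[OF _ space_derivatives(2)[OF xt]]) simp
  then have "((\<lambda>y. pressure K \<gamma> \<tau> y t) has_real_derivative
      K * ((- \<gamma>) * \<tau> x t powr (- \<gamma> - of_nat 1) * dx \<tau> x t)) (at x)"
    unfolding pressure_def by (rule DERIV_cmult)
  then have "dx (pressure K \<gamma> \<tau>) x t = K * ((- \<gamma>) * \<tau> x t powr (- \<gamma> - of_nat 1) * dx \<tau> x t)"
    unfolding dx_def by (rule DERIV_imp_deriv)
  then show ?thesis using dt_u[OF xt] speed_squared[OF xt] by (simp add: algebra_simps)
qed

text \<open>
  The transport equations, in the only form used: at each point the invariant has derivative \<open>0\<close>
  in the direction of the straight line tangent to the characteristic, run backwards in time. This holds because
  \<open>u_t = c\<^sup>2 \<tau>_x\<close>, \<open>\<tau>_t = u_x\<close> and \<open>d\<eta>/d\<tau> = - c\<close>.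
\<close>

lemma fwd_inv_transport:
  assumes "(x, t) \<in> strip T" "0 < t"
  shows "((\<lambda>h. fwd_inv (x - h * c x t) (t - h)) has_real_derivative 0) (at 0)"
proof -
  let ?c = "c x t"
  have fwd_inv_eq: "fwd_inv = (\<lambda>x t. u x t + 2 * sqrt (K * \<gamma>) / (\<gamma> - 1) * \<tau> x t powr (- ((\<gamma> - 1) / 2)))"
    by (simp add: fwd_inv_def eta_def fun_eq_iff)
  note d = C1_on_strip_directional_derivative[OF _ assms, of _ "- ?c"]
  have "((\<lambda>h. fwd_inv (x + h * - ?c) (t - h)) has_real_derivative
      (- ?c * dx u x t - dt u x t) + - ?c * (- ?c * dx \<tau> x t - dt \<tau> x t)) (at 0)"
    unfolding fwd_inv_eq
    by (rule DERIV_add[OF d[OF u_C1] DERIV_eta[OF assms(1) d[OF tau_C1]]]) simp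
  moreover have "(- ?c * dx u x t - dt u x t) + - ?c * (- ?c * dx \<tau> x t - dt \<tau> x t) = 0"
    by (simp add: momentum[OF assms(1)] dt_tau[OF assms(1)] algebra_simps)
  ultimately show ?thesis by simp
qed

lemma bwd_inv_transport:
  assumes "(x, t) \<in> strip T" "0 < t"
  shows "((\<lambda>h. bwd_inv (x + h * c x t) (t - h)) has_real_derivative 0) (at 0)"
proof -
  let ?c = "c x t"
  have bwd_inv_eq: "bwd_inv = (\<lambda>x t. u x t - 2 * sqrt (K * \<gamma>) / (\<gamma> - 1) * \<tau> x t powr (- ((\<gamma> - 1) / 2)))"
    by (simp add: bwd_inv_def eta_def fun_eq_iff)
  note d = C1_on_strip_directional_derivative[OF _ assms, of _ ?c]
  have "((\<lambda>h. bwd_inv (x + h * ?c) (t - h)) has_real_derivative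
      (?c * dx u x t - dt u x t) - - ?c * (?c * dx \<tau> x t - dt \<tau> x t)) (at 0)"
    unfolding bwd_inv_eq
    by (rule DERIV_diff[OF d[OF u_C1] DERIV_eta[OF assms(1) d[OF tau_C1]]]) simp
  moreover have "(?c * dx u x t - dt u x t) - - ?c * (?c * dx \<tau> x t - dt \<tau> x t) = 0"
    by (simp add: momentum[OF assms(1)] dt_tau[OF assms(1)] algebra_simps)
  ultimately show ?thesis by simp
qed

lemma continuous_on_invariants:
  "continuous_on (strip T) (\<lambda>p. fwd_inv (fst p) (snd p))"
  "continuous_on (strip T) (\<lambda>p. bwd_inv (fst p) (snd p))"
proof -
  have u: "continuous_on (strip T) (\<lambda>p. u (fst p) (snd p))"
    and tau: "continuous_on (strip T) (\<lambda>p. \<tau> (fst p) (snd p))"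
    using u_C1 tau_C1 by (simp_all add: C1_on_strip_def case_prod_unfold)
  have "continuous_on (strip T) (\<lambda>p. \<eta> (fst p) (snd p))"
    unfolding eta_def using tau_pos by (intro continuous_intros tau) force
  then show "continuous_on (strip T) (\<lambda>p. fwd_inv (fst p) (snd p))"
    "continuous_on (strip T) (\<lambda>p. bwd_inv (fst p) (snd p))"
    unfolding fwd_inv_def bwd_inv_def by (intro continuous_intros u; assumption)+
qed

lemma invariant_space_derivatives:
  assumes "(x, t) \<in> strip T"
  shows "((\<lambda>y. fwd_inv y t) has_real_derivative alpha K \<gamma> u \<tau> x t) (at x)"
    and "((\<lambda>y. bwd_inv y t) has_real_derivative beta K \<gamma> u \<tau> x t) (at x)"
proof -
  have "((\<lambda>y. \<eta> y t) has_real_derivative dx \<eta> x t) (at x)"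
    using eta_space_derivative[OF assms] unfolding dx_def by (metis DERIV_imp_deriv)
  then show "((\<lambda>y. fwd_inv y t) has_real_derivative alpha K \<gamma> u \<tau> x t) (at x)"
    "((\<lambda>y. bwd_inv y t) has_real_derivative beta K \<gamma> u \<tau> x t) (at x)"
    unfolding fwd_inv_def bwd_inv_def alpha_def beta_def
    using space_derivatives(1)[OF assms] by (auto intro!: derivative_intros)
qed

section \<open>Finite propagation speed\<close>

lemma invariants_initially_bounded:
  assumes T: "0 < T"
    and "bounded (range (\<lambda>x. u x 0))" and "bounded (range (\<lambda>x. rho \<tau> x 0))"
  obtains B where "\<And>x. \<bar>fwd_inv x 0\<bar> \<le> B" "\<And>x. \<bar>bwd_inv x 0\<bar> \<le> B"
proof -
  obtain U where U: "\<And>x. \<bar>u x 0\<bar> \<le> U" using assms(2) by (auto simp: bounded_iff)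
  obtain P where P: "\<And>x. \<bar>rho \<tau> x 0\<bar> \<le> P" using assms(3) by (auto simp: bounded_iff)
  define E where "E = 2 * sqrt (K * \<gamma>) / (\<gamma> - 1) * P powr ((\<gamma> - 1) / 2)"
  have "\<eta> x 0 \<le> E" for x
  proof -
    have pos: "0 < \<tau> x 0" using tau_pos T by (simp add: strip_def zero_ereal_def)
    then have "1 / \<tau> x 0 \<le> P" using P[of x] by (simp add: rho_def)
    then have "(1 / \<tau> x 0) powr ((\<gamma> - 1) / 2) \<le> P powr ((\<gamma> - 1) / 2)"
      using pos gamma by (intro powr_mono2) auto
    then have "\<tau> x 0 powr (- ((\<gamma> - 1) / 2)) \<le> P powr ((\<gamma> - 1) / 2)"
      using pos by (simp only: powr_minus_divide powr_divide powr_one_eq_one)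
    then show ?thesis unfolding E_def eta_def using sound_factor_pos gamma by (intro mult_left_mono) auto
  qed
  then have "\<bar>fwd_inv x 0\<bar> \<le> U + E" "\<bar>bwd_inv x 0\<bar> \<le> U + E" for x
    using U[of x] eta_nonneg[of x 0] unfolding fwd_inv_def bwd_inv_def abs_le_iff by (smt (verit, best))+
  then show thesis using that by blast
qed

text \<open>
  The trapezoid below \<open>(x, t)\<close> has the slope \<open>speed (B + 1)\<close> throughout. The barrier \<open>b\<close> increases
  strictly in time and reaches \<open>B + 1\<close> at \<open>t\<close>. Where one of \<open>\<plusminus>(u + \<eta>)\<close>, \<open>\<plusminus>(u - \<eta>)\<close> meets it first,
  the sound speed is at most the slope; so one can go back a little along the characteristic
  direction without leaving the trapezoid. The invariant is stationary and the barrier was lower, so it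
  had been exceeded already.
\<close>

lemma invariants_bounded:
  assumes init: "\<And>x. \<bar>fwd_inv x 0\<bar> \<le> B" "\<And>x. \<bar>bwd_inv x 0\<bar> \<le> B"
    and xt: "(x, t) \<in> strip T"
  shows "\<bar>fwd_inv x t\<bar> < B + 1 \<and> \<bar>bwd_inv x t\<bar> < B + 1"
proof -
  define C where "C = speed (B + 1)"
  define D where "D = {(y, s). 0 \<le> s \<and> s \<le> t \<and> \<bar>y\<bar> \<le> \<bar>x\<bar> + C * (t - s)}"
  define b where "b s = B + (1 + s) / (1 + t)" for s
  define G where "G p = max \<bar>fwd_inv (fst p) (snd p)\<bar> \<bar>bwd_inv (fst p) (snd p)\<bar> - b (snd p)" for p
  have t: "0 \<le> t" "ereal t < T" using xt by (auto simp: strip_def)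
  have C: "0 \<le> C" unfolding C_def by (rule speed_nonneg)
  have D_strip: "D \<subseteq> strip T"
    using t by (auto simp: D_def strip_def intro: le_less_trans[of "ereal _" "ereal t"])
  have b_le: "b s \<le> B + 1" if "s \<le> t" for s
    using that t by (simp add: b_def field_simps)
  have "G (x, t) < 0"
  proof (rule negative_if_no_first_zero[where D = D])
    show "compact D" unfolding D_def by (rule compact_trapezoid)
    show "continuous_on D G"
      unfolding G_def b_def using t
      by (intro continuous_intros continuous_on_invariants[THEN continuous_on_subset, OF D_strip]) auto
    show "(x, t) \<in> D" using t by (simp add: D_def)
    show "0 \<le> s" if "(y, s) \<in> D" for y s using that by (simp add: D_def)
    show "(y, s') \<in> D" if "(y, s) \<in> D" "0 \<le> s'" "s' \<le> s" for y s s'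
    proof -
      have "C * (t - s) \<le> C * (t - s')" using that C by (intro mult_left_mono) auto
      then show ?thesis using that by (auto simp: D_def)
    qed
    show "G (y, 0) < 0" if "(y, 0) \<in> D" for y
    proof -
      have "B < b 0" using t by (simp add: b_def)
      then show ?thesis using init(1)[of y] init(2)[of y] by (simp add: G_def)
    qed
    show "\<exists>y' s'. (y', s') \<in> D \<and> s' < s \<and> 0 \<le> G (y', s')"
      if ys: "(y, s) \<in> D" "0 < s" "G (y, s) = 0" for y s
    proof -
      have ys_strip: "(y, s) \<in> strip T" using D_strip ys by blast
      have s: "s \<le> t" "\<bar>y\<bar> \<le> \<bar>x\<bar> + C * (t - s)" using ys by (auto simp: D_def)
      have bound: "max \<bar>fwd_inv y s\<bar> \<bar>bwd_inv y s\<bar> = b s" using ys by (simp add: G_def)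
      then have "\<eta> y s \<le> B + 1"
        using b_le[OF s(1)] by (auto simp: fwd_inv_def bwd_inv_def max_def abs_if split: if_splits)
      then have c_le: "c y s \<le> C" unfolding C_def by (intro speed_mono eta_nonneg)
      \<comment> \<open>\<open>g\<close> stands for the one of the four functions that touches the barrier.\<close>
      have step: ?thesis
        if g_le: "\<And>y s. g y s \<le> max \<bar>fwd_inv y s\<bar> \<bar>bwd_inv y s\<bar>"
          and deriv: "((\<lambda>h. g (y + h * v) (s - h)) has_real_derivative 0) (at 0)"
          and v: "\<bar>v\<bar> \<le> C" and touch: "g y s = b s" for g v
      proof -
        have "((\<lambda>h. 1 + (s - h)) has_real_derivative - 1) (at 0)"
          by (auto intro!: derivative_eq_intros)
        from DERIV_add[OF DERIV_const[of B] DERIV_cdivide[OF this, of "1 + t"]]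
        have "((\<lambda>h. b (s - h)) has_real_derivative - (1 / (1 + t))) (at 0)"
          by (simp add: b_def)
        from DERIV_diff[OF deriv this]
        have "eventually (\<lambda>h. 0 \<le> g (y + h * v) (s - h) - b (s - h)) (at_right 0)"
          by (rule increases_backwards) (use t touch in auto)
        moreover have "eventually (\<lambda>h::real. h < s) (at_right 0)"
          using ys(2) by (auto simp: eventually_at_right_field)
        moreover have "eventually (\<lambda>h::real. 0 < h) (at_right 0)"
          by (rule eventually_at_right_less)
        ultimately have "eventually (\<lambda>h. 0 < h \<and> h < s \<and> 0 \<le> g (y + h * v) (s - h) - b (s - h)) (at_right 0)"
          by eventually_elim auto
        then obtain h where h: "0 < h" "h < s" "0 \<le> g (y + h * v) (s - h) - b (s - h)"
          using eventually_happens'[OF trivial_limit_at_right_real] by blast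
        have "\<bar>h * v\<bar> \<le> C * h" using h v by (simp add: abs_mult mult.commute mult_left_mono)
        then have "\<bar>y + h * v\<bar> \<le> \<bar>x\<bar> + C * (t - (s - h))" using s(2) by (simp add: algebra_simps)
        then have "(y + h * v, s - h) \<in> D" using h s by (simp add: D_def)
        moreover have "0 \<le> G (y + h * v, s - h)"
          using h(3) g_le[of "y + h * v" "s - h"] by (simp add: G_def)
        ultimately show ?thesis using h(1) by (intro exI[of _ "y + h * v"] exI[of _ "s - h"]) simp
      qed
      have v: "\<bar>- c y s\<bar> \<le> C" "\<bar>c y s\<bar> \<le> C" using c_le speed_nonneg[of "\<eta> y s"] by auto
      have fwd_deriv: "((\<lambda>h. fwd_inv (y + h * - c y s) (s - h)) has_real_derivative 0) (at 0)"
        using fwd_inv_transport[OF ys_strip ys(2)] by simp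
      note bwd_deriv = bwd_inv_transport[OF ys_strip ys(2)]
      consider "fwd_inv y s = b s" | "- fwd_inv y s = b s" | "bwd_inv y s = b s" | "- bwd_inv y s = b s"
        using bound by (auto simp: max_def abs_if split: if_splits)
      then show ?thesis
      proof cases
        case 1
        show ?thesis by (rule step[of fwd_inv, OF _ fwd_deriv v(1) 1]) auto
      next
        case 2
        show ?thesis
          by (rule step[of "\<lambda>y s. - fwd_inv y s", OF _ _ v(1) 2]) (use DERIV_minus[OF fwd_deriv] in auto)
      next
        case 3
        show ?thesis by (rule step[of bwd_inv, OF _ bwd_deriv v(2) 3]) auto
      next
        case 4
        show ?thesis
          by (rule step[of "\<lambda>y s. - bwd_inv y s", OF _ _ v(2) 4]) (use DERIV_minus[OF bwd_deriv] in auto)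
      qed
    qed
  qed
  then show ?thesis using b_le[of t] by (simp add: G_def)
qed

section \<open>Bounds on the gradients of the invariants\<close>

text \<open>
  Doubling of the space variable: the compact set consists of pairs \<open>z \<le> w\<close> in the same time slice
  of a trapezoid. For an invariant \<open>g\<close> the difference \<open>g(w) - g(z) - N (w - z)\<close> vanishes on the diagonal at all times; the
  term \<open>\<delta> (1 + t)\<close> makes the diagonal strictly admissible, so a first failure occurs at
  \<open>z < w\<close>, where there is room to move both points, and its growth in time makes the comparison strict.
\<close>

lemma one_sided_lipschitz_preserved:
  assumes C: "\<And>x t. (x, t) \<in> strip T \<Longrightarrow> c x t \<le> C" and N: "0 \<le> N"
    and init: "\<And>x y. x \<le> y \<Longrightarrow> fwd_inv y 0 - fwd_inv x 0 \<le> N * (y - x)"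
      "\<And>x y. x \<le> y \<Longrightarrow> bwd_inv y 0 - bwd_inv x 0 \<le> N * (y - x)"
    and t: "(0, t) \<in> strip T" and xy: "x \<le> y" and \<delta>: "0 < \<delta>"
  shows "max (fwd_inv y t - fwd_inv x t) (bwd_inv y t - bwd_inv x t) < N * (y - x) + \<delta> * (1 + t)"
proof -
  define S where "S = {(z, s). 0 \<le> s \<and> s \<le> t \<and> \<bar>z\<bar> \<le> (\<bar>x\<bar> + \<bar>y\<bar>) + C * (t - s)}"
  define D where "D = {((z, w), s). z \<le> w \<and> (z, s) \<in> S \<and> (w, s) \<in> S}"
  define b where "b z w s = N * (w - z) + \<delta> * (1 + s)" for z w s
  define d where "d g z w s = g w s - (g z s :: real)" for g :: "real \<Rightarrow> real \<Rightarrow> real" and z w s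
  define G where "G = (\<lambda>((z, w), s). max (d fwd_inv z w s) (d bwd_inv z w s) - b z w s)"
  have t: "0 \<le> t" "ereal t < T" using t by (auto simp: strip_def)
  have C_nonneg: "0 \<le> C"
    using C[of 0 t] speed_nonneg[of "\<eta> 0 t"] t by (simp add: strip_def)
  have S_strip: "S \<subseteq> strip T"
    using t by (auto simp: S_def strip_def intro: le_less_trans[of "ereal _" "ereal t"])
  have "G ((x, y), t) < 0"
  proof (rule negative_if_no_first_zero[where D = D])
    show "compact D"
    proof -
      let ?P = "(S \<times> S) \<inter> {q. snd (fst q) = snd (snd q) \<and> fst (fst q) \<le> fst (snd q)}"
      have "compact S" unfolding S_def by (rule compact_trapezoid)
      then have "compact ?P"
        by (intro compact_Int_closed compact_Times closed_Collect_conj closed_Collect_eq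
            closed_Collect_le continuous_intros)
      then have "compact ((\<lambda>q. ((fst (fst q), fst (snd q)), snd (fst q))) ` ?P)"
        by (rule compact_continuous_image[rotated]) (intro continuous_intros)
      moreover have "(\<lambda>q. ((fst (fst q), fst (snd q)), snd (fst q))) ` ?P = D"
        by (force simp: D_def image_iff)
      ultimately show ?thesis by simp
    qed
    show "continuous_on D G"
    proof -
      have *: "continuous_on D (\<lambda>q. g (fst (fst q)) (snd q))" "continuous_on D (\<lambda>q. g (snd (fst q)) (snd q))"
        if "continuous_on (strip T) (\<lambda>p. g (fst p) (snd p))" for g :: "real \<Rightarrow> real \<Rightarrow> real"
      proof -
        have "continuous_on D (\<lambda>q. (\<lambda>p. g (fst p) (snd p)) (fst (fst q), snd q))"
          using S_strip by (intro continuous_on_compose2[OF that] continuous_intros) (auto simp: D_def)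
        moreover have "continuous_on D (\<lambda>q. (\<lambda>p. g (fst p) (snd p)) (snd (fst q), snd q))"
          using S_strip by (intro continuous_on_compose2[OF that] continuous_intros) (auto simp: D_def)
        ultimately show "continuous_on D (\<lambda>q. g (fst (fst q)) (snd q))"
          "continuous_on D (\<lambda>q. g (snd (fst q)) (snd q))" by simp_all
      qed
      show ?thesis
        unfolding G_def d_def b_def case_prod_unfold
        by (intro continuous_intros * continuous_on_invariants)
    qed
    have "0 \<le> C * t" using C_nonneg t by simp
    then show "((x, y), t) \<in> D" using t xy by (simp add: D_def S_def)
    show "0 \<le> s" if "(p, s) \<in> D" for p s using that by (auto simp: D_def S_def)
    show "(p, s') \<in> D" if "(p, s) \<in> D" "0 \<le> s'" "s' \<le> s" for p s s'
    proof -
      have "C * (t - s) \<le> C * (t - s')" using that C_nonneg by (intro mult_left_mono) auto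
      then show ?thesis using that by (auto simp: D_def S_def)
    qed
    show "G (p, 0) < 0" if "(p, 0) \<in> D" for p
      using that init[of "fst p" "snd p"] \<delta> by (auto simp: D_def G_def d_def b_def)
    show "\<exists>p' s'. (p', s') \<in> D \<and> s' < s \<and> 0 \<le> G (p', s')"
      if ps: "(p, s) \<in> D" "0 < s" "G (p, s) = 0" for p s
    proof -
      obtain z w where p: "p = (z, w)" by fastforce
      have zS: "(z, s) \<in> S" and wS: "(w, s) \<in> S" and "z \<le> w" using ps p by (auto simp: D_def)
      have bound: "max (d fwd_inv z w s) (d bwd_inv z w s) = b z w s" using ps p by (simp add: G_def)
      have "z \<noteq> w"
      proof
        assume "z = w"
        then have "\<delta> * (1 + s) = 0" using bound by (simp add: d_def b_def)
        then show False using \<delta> ps(2) by simp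
      qed
      then have "z < w" using \<open>z \<le> w\<close> by simp
      have b_nonneg: "0 \<le> b z w s" using N \<open>z \<le> w\<close> \<delta> ps(2) by (simp add: b_def)
      have strips: "(z, s) \<in> strip T" "(w, s) \<in> strip T" using S_strip zS wS by auto
      \<comment> \<open>Going back with velocities \<open>v' \<le> v\<close> does not increase the distance of \<open>z\<close> and \<open>w\<close>, so the
        barrier \<open>b\<close> decreases while the increment of \<open>g\<close> is stationary.\<close>
      have step: ?thesis
        if g_le: "\<And>z w s. d g z w s \<le> max (d fwd_inv z w s) (d bwd_inv z w s)"
          and deriv: "((\<lambda>h. g (z + h * v) (s - h)) has_real_derivative 0) (at 0)"
            "((\<lambda>h. g (w + h * v') (s - h)) has_real_derivative 0) (at 0)"
          and v: "\<bar>v\<bar> \<le> C" "\<bar>v'\<bar> \<le> C" "v' \<le> v" and touch: "d g z w s = b z w s" for g v v'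
      proof -
        have b': "((\<lambda>h. b (z + h * v) (w + h * v') (s - h)) has_real_derivative (N * (v' - v) - \<delta>)) (at 0)"
          unfolding b_def by (auto intro!: derivative_eq_intros)
        have "N * (v' - v) \<le> 0" using N v(3) by (simp add: mult_nonneg_nonpos)
        then have "0 < (0 - 0) - (N * (v' - v) - \<delta>)" using \<delta> by simp
        from increases_backwards[OF DERIV_diff[OF DERIV_diff[OF deriv(2) deriv(1)] b'] this]
        have "eventually (\<lambda>h. 0 \<le> d g (z + h * v) (w + h * v') (s - h) - b (z + h * v) (w + h * v') (s - h))
            (at_right 0)"
          using touch by (simp add: d_def)
        moreover have "eventually (\<lambda>h::real. h < s) (at_right 0)"
          using ps(2) by (auto simp: eventually_at_right_field)
        moreover have "eventually (\<lambda>h::real. 0 < h) (at_right 0)"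
          by (rule eventually_at_right_less)
        moreover have "eventually (\<lambda>h. z + h * v < w + h * v') (at_right 0)"
        proof -
          have "((\<lambda>h. (w + h * v') - (z + h * v)) \<longlongrightarrow> (w + 0 * v') - (z + 0 * v)) (at_right 0)"
            by (intro tendsto_intros)
          then have "eventually (\<lambda>h. 0 < (w + h * v') - (z + h * v)) (at_right 0)"
            by (rule order_tendstoD) (use \<open>z < w\<close> in simp)
          then show ?thesis by eventually_elim simp
        qed
        ultimately have "eventually (\<lambda>h. 0 < h \<and> h < s \<and> z + h * v < w + h * v' \<and>
            0 \<le> d g (z + h * v) (w + h * v') (s - h) - b (z + h * v) (w + h * v') (s - h)) (at_right 0)"
          by eventually_elim auto
        then obtain h where h: "0 < h" "h < s" "z + h * v < w + h * v'"
          "0 \<le> d g (z + h * v) (w + h * v') (s - h) - b (z + h * v) (w + h * v') (s - h)"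
          using eventually_happens'[OF trivial_limit_at_right_real] by blast
        have in_S: "(a + h * e, s - h) \<in> S" if "(a, s) \<in> S" "\<bar>e\<bar> \<le> C" for a e
        proof -
          have "\<bar>h * e\<bar> \<le> C * h" using h that by (simp add: abs_mult mult.commute mult_left_mono)
          then have "\<bar>a + h * e\<bar> \<le> \<bar>a\<bar> + C * h" by linarith
          then show ?thesis using that(1) h by (simp add: S_def algebra_simps)
        qed
        have "((z + h * v, w + h * v'), s - h) \<in> D"
          using in_S[OF zS v(1)] in_S[OF wS v(2)] h by (simp add: D_def)
        moreover have "0 \<le> G ((z + h * v, w + h * v'), s - h)"
          using h(4) g_le[of "z + h * v" "w + h * v'" "s - h"] by (simp add: G_def)
        ultimately show ?thesis
          using h(1) by (intro exI[of _ "(z + h * v, w + h * v')"] exI[of _ "s - h"]) simp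
      qed
      have speeds: "\<bar>c z s\<bar> \<le> C" "\<bar>c w s\<bar> \<le> C" "\<bar>- c z s\<bar> \<le> C" "\<bar>- c w s\<bar> \<le> C"
        using C[OF strips(1)] C[OF strips(2)] speed_nonneg[of "\<eta> z s"] speed_nonneg[of "\<eta> w s"] by auto
      \<comment> \<open>The invariant with the larger increment decides how the two sound speeds compare, and in
        both cases the ordering is the one that keeps the points from moving apart backwards.\<close>
      have eta_diff: "2 * (\<eta> w s - \<eta> z s) = d fwd_inv z w s - d bwd_inv z w s"
        by (simp add: d_def fwd_inv_def bwd_inv_def)
      consider "d fwd_inv z w s = b z w s" "d bwd_inv z w s \<le> b z w s"
        | "d bwd_inv z w s = b z w s" "d fwd_inv z w s \<le> b z w s"
        using bound by (auto simp: max_def split: if_splits)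
      then show ?thesis
      proof cases
        case 1
        then have "c z s \<le> c w s" using eta_diff by (intro speed_mono eta_nonneg) simp
        then show ?thesis
          using step[of fwd_inv "- c z s" "- c w s"] speeds 1
            fwd_inv_transport[OF strips(1) ps(2)] fwd_inv_transport[OF strips(2) ps(2)] by simp
      next
        case 2
        then have "c w s \<le> c z s" using eta_diff by (intro speed_mono eta_nonneg) simp
        then show ?thesis
          using step[of bwd_inv "c z s" "c w s"] speeds 2
            bwd_inv_transport[OF strips(1) ps(2)] bwd_inv_transport[OF strips(2) ps(2)] by simp
      qed
    qed
  qed
  then show ?thesis by (simp add: G_def d_def b_def)
qed

lemma gradients_bounded:
  assumes T: "0 < T"
    and "bounded (range (\<lambda>x. u x 0))" and "bounded (range (\<lambda>x. rho \<tau> x 0))"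
    and N: "0 \<le> N" "\<And>x. alpha K \<gamma> u \<tau> x 0 \<le> N" "\<And>x. beta K \<gamma> u \<tau> x 0 \<le> N"
    and xt: "(x, t) \<in> strip T"
  shows "alpha K \<gamma> u \<tau> x t \<le> N \<and> beta K \<gamma> u \<tau> x t \<le> N"
proof -
  obtain B where B: "\<And>x. \<bar>fwd_inv x 0\<bar> \<le> B" "\<And>x. \<bar>bwd_inv x 0\<bar> \<le> B"
    using invariants_initially_bounded[OF assms(1-3)] by blast
  have C: "c y s \<le> speed (B + 1)" if "(y, s) \<in> strip T" for y s
  proof -
    have "\<eta> y s \<le> B + 1" using invariants_bounded[OF B that] by (auto simp: fwd_inv_def bwd_inv_def)
    then show ?thesis by (intro speed_mono eta_nonneg)
  qed
  have zero: "(y, 0) \<in> strip T" for y using T by (simp add: strip_def zero_ereal_def)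
  note init = lipschitz_if_derivative_le[OF invariant_space_derivatives(1)[OF zero] N(2)]
    lipschitz_if_derivative_le[OF invariant_space_derivatives(2)[OF zero] N(3)]
  have t: "(0, t) \<in> strip T" "0 \<le> t" using xt by (auto simp: strip_def)
  have lip: "max (fwd_inv z t - fwd_inv y t) (bwd_inv z t - bwd_inv y t) \<le> N * (z - y)" if "y \<le> z" for y z
  proof (rule field_le_epsilon)
    fix e :: real assume "0 < e"
    then have "0 < e / (1 + t)" using t by simp
    from one_sided_lipschitz_preserved[OF C N(1) init t(1) that this]
    show "max (fwd_inv z t - fwd_inv y t) (bwd_inv z t - bwd_inv y t) \<le> N * (z - y) + e" using t by simp
  qed
  show ?thesis
    using derivative_le_if_lipschitz[OF invariant_space_derivatives(1)[OF xt]]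
      derivative_le_if_lipschitz[OF invariant_space_derivatives(2)[OF xt]] lip by simp
qed

section \<open>Linear growth of the specific volume\<close>

lemma tau_growth:
  assumes N: "\<And>s. (x, s) \<in> strip T \<Longrightarrow> dx u x s \<le> N" and xt: "(x, t) \<in> strip T"
  shows "\<tau> x t \<le> \<tau> x 0 + N * t"
proof -
  have t: "0 \<le> t" "ereal t < T" using xt by (auto simp: strip_def)
  have strip: "(x, s) \<in> strip T" if "0 \<le> s" "s \<le> t" for s
    using that t by (auto simp: strip_def intro: le_less_trans[of "ereal s" "ereal t"])
  have deriv: "((\<lambda>s. \<tau> x s) has_vector_derivative dx u x s) (at s within {0..})"
    if "0 \<le> s" "s \<le> t" for s
  proof -
    have "(\<lambda>s. \<tau> x s) differentiable (at s within {0..})"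
      using tau_C1 strip[OF that] by (auto simp: C1_on_strip_def)
    then have "((\<lambda>s. \<tau> x s) has_vector_derivative dt \<tau> x s) (at s within {0..})"
      unfolding dt_def by (simp add: vector_derivative_works)
    then show ?thesis using dt_tau[OF strip[OF that]] by simp
  qed
  have "N * 0 - \<tau> x 0 \<le> N * t - \<tau> x t"
  proof (rule DERIV_nonneg_imp_increasing_open[OF t(1)])
    fix s assume s: "0 < s" "s < t"
    have "((\<lambda>s. \<tau> x s) has_vector_derivative dx u x s) (at s within {0<..})"
      by (rule has_vector_derivative_within_subset[OF deriv]) (use s in auto)
    then have "((\<lambda>s. \<tau> x s) has_real_derivative dx u x s) (at s)"
      using s at_within_open[of s "{0<..}"] by (simp add: has_real_derivative_iff_has_vector_derivative)
    then have "((\<lambda>s. N * s - \<tau> x s) has_real_derivative N - dx u x s) (at s)"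
      by (auto intro!: derivative_eq_intros)
    then show "\<exists>d. ((\<lambda>s. N * s - \<tau> x s) has_real_derivative d) (at s) \<and> 0 \<le> d"
      using N[OF strip] s by fastforce
  next
    have "continuous_on {0..t} (\<lambda>s. \<tau> x s)"
      unfolding continuous_on_eq_continuous_within
      using deriv has_vector_derivative_continuous
      by (metis atLeastAtMost_iff atLeast_iff continuous_within_subset subsetI)
    then show "continuous_on {0..t} (\<lambda>s. N * s - \<tau> x s)" by (intro continuous_intros)
  qed
  then show ?thesis by simp
qed

text \<open>
  Otherwise \<open>u_x = (\<alpha> + \<beta>) / 2 \<le> m < 0\<close> everywhere at time \<open>0\<close>, and \<open>u\<close> would tend to \<open>-\<infinity>\<close>. This
  excludes \<open>M \<le> 0\<close> in the theorem.
\<close>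

lemma bounded_velocity_gradient_not_negative:
  assumes T: "0 < T" and "bounded (range (\<lambda>x. u x 0))" and "m < 0"
  shows "\<exists>x. m < alpha K \<gamma> u \<tau> x 0 \<or> m < beta K \<gamma> u \<tau> x 0"
proof (rule ccontr)
  assume "\<not> ?thesis"
  then have le: "alpha K \<gamma> u \<tau> x 0 \<le> m" "beta K \<gamma> u \<tau> x 0 \<le> m" for x
    by (auto simp: not_less)
  have "dx u x 0 \<le> m" for x using le[of x] by (simp add: alpha_def beta_def)
  moreover have "(x, 0) \<in> strip T" for x using T by (simp add: strip_def zero_ereal_def)
  ultimately have slope: "u y 0 - u x 0 \<le> m * (y - x)" if "x \<le> y" for x y
    using lipschitz_if_derivative_le[of "\<lambda>x. u x 0" "\<lambda>x. dx u x 0" m x y] space_derivatives(1) that by blast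
  obtain U where U: "\<And>x. \<bar>u x 0\<bar> \<le> U" using assms(2) by (auto simp: bounded_iff)
  have "0 \<le> U" using U[of 0] by linarith
  define y where "y = (2 * U + 1) / (- m)"
  have "m * y = - (2 * U + 1)" "0 \<le> y" using \<open>m < 0\<close> \<open>0 \<le> U\<close> by (auto simp: y_def field_simps)
  then show False using slope[of 0 y] U[of 0] U[of y] by (simp add: abs_le_iff)
qed

end

theorem theorem2p1:
  fixes K \<gamma> M :: real and u0 \<tau>0 :: "real \<Rightarrow> real"
  assumes "K > 0" and "\<gamma> > 1"
  shows "\<exists>M1>0. \<exists>M2>0. \<forall>(T::ereal) u \<tau>.
    0 < T \<longrightarrow>
    p_system_C1_solution K \<gamma> T u \<tau> \<longrightarrow>
    (\<forall>x. u x 0 = u0 x) \<longrightarrow>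
    (\<forall>x. \<tau> x 0 = \<tau>0 x) \<longrightarrow>
    bounded (range (\<lambda>x. u x 0)) \<longrightarrow>
    bounded (range (\<lambda>x. \<tau> x 0)) \<longrightarrow>
    bounded (range (\<lambda>x. rho \<tau> x 0)) \<longrightarrow>
    bounded (range (\<lambda>x. alpha K \<gamma> u \<tau> x 0)) \<longrightarrow>
    bounded (range (\<lambda>x. beta K \<gamma> u \<tau> x 0)) \<longrightarrow>
    (SUP x. ereal (max (alpha K \<gamma> u \<tau> x 0) (beta K \<gamma> u \<tau> x 0))) < ereal M \<longrightarrow>
      (SUP (x, t)\<in>strip T. ereal (max (alpha K \<gamma> u \<tau> x t) (beta K \<gamma> u \<tau> x t))) < ereal M \<and>
      (SUP (x, t)\<in>strip T. ereal (dt \<tau> x t)) = (SUP (x, t)\<in>strip T. ereal (dx u x t)) \<and>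
      (SUP (x, t)\<in>strip T. ereal (dx u x t)) < ereal M \<and>
      (\<forall>t. 0 \<le> t \<and> ereal t < T \<longrightarrow> ereal (M1 / (M2 + t)) \<le> (INF x. ereal (rho \<tau> x t)))"
proof -
  \<comment> \<open>The constants are chosen before the solution. The values \<open>1\<close> only keep \<open>A\<close> and \<open>L\<close> positive: for
    \<open>M \<le> 0\<close> no solution satisfies the assumptions.\<close>
  define A where "A = max 1 (SUP x. \<tau>0 x)"
  define L where "L = (if 0 < M then M else 1)"
  have "0 < A" "0 < L" by (auto simp: A_def L_def)
  show ?thesis
  proof (rule exI[of _ "1 / L"], rule conjI, use \<open>0 < L\<close> in simp,
      rule exI[of _ "A / L"], rule conjI, use \<open>0 < A\<close> \<open>0 < L\<close> in simp, intro allI impI)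
    fix T :: ereal and u \<tau> :: "real \<Rightarrow> real \<Rightarrow> real"
    assume T: "0 < T" and sol: "p_system_C1_solution K \<gamma> T u \<tau>"
      and \<tau>0: "\<forall>x. \<tau> x 0 = \<tau>0 x"
      and u_bdd: "bounded (range (\<lambda>x. u x 0))" and \<tau>_bdd: "bounded (range (\<lambda>x. \<tau> x 0))"
      and \<rho>_bdd: "bounded (range (\<lambda>x. rho \<tau> x 0))"
      and M: "(SUP x. ereal (max (alpha K \<gamma> u \<tau> x 0) (beta K \<gamma> u \<tau> x 0))) < ereal M"
    interpret p_system K \<gamma> T u \<tau> using assms sol by unfold_locales
    let ?a = "alpha K \<gamma> u \<tau>" and ?b = "beta K \<gamma> u \<tau>"
    let ?S = "SUP x. ereal (max (?a x 0) (?b x 0))"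
    have S_upper: "ereal (max (?a x 0) (?b x 0)) \<le> ?S" for x by (rule SUP_upper) simp
    \<comment> \<open>The Lipschitz constant \<open>N\<close> must be nonnegative, and for the strict conclusion also below \<open>M\<close>.\<close>
    have "0 \<le> ?S"
    proof (rule ccontr)
      assume "\<not> 0 \<le> ?S"
      then obtain m where m: "?S < ereal m" "ereal m < 0" using ereal_dense2[of ?S 0] by (auto simp: not_le)
      then obtain x where "m < max (?a x 0) (?b x 0)"
        using bounded_velocity_gradient_not_negative[OF T u_bdd, of m] by (auto simp: less_max_iff_disj)
      then show False using m S_upper[of x] by (meson ereal_less(2) less_ereal.simps(1) less_le_trans not_le order.strict_trans)
    qed
    obtain N where N: "?S < ereal N" "ereal N < ereal M" using ereal_dense2[OF M] by blast
    have N0: "0 \<le> N" "N < M" using N \<open>0 \<le> ?S\<close> by (auto dest: le_less_trans)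
    have "?a x 0 \<le> N" "?b x 0 \<le> N" for x
      using le_less_trans[OF S_upper[of x] N(1)] by auto
    then have grad: "?a x t \<le> N \<and> ?b x t \<le> N" if "(x, t) \<in> strip T" for x t
      using gradients_bounded[OF T u_bdd \<rho>_bdd N0(1) _ _ that] by blast
    have ux: "dx u x t \<le> N" if "(x, t) \<in> strip T" for x t
      using grad[OF that] by (simp add: alpha_def beta_def)
    have "(SUP (x, t)\<in>strip T. ereal (max (?a x t) (?b x t))) \<le> ereal N"
      using grad by (auto intro!: SUP_least)
    moreover have "(SUP (x, t)\<in>strip T. ereal (dt \<tau> x t)) = (SUP (x, t)\<in>strip T. ereal (dx u x t))"
      using dt_tau by (intro SUP_cong) auto
    moreover have "(SUP (x, t)\<in>strip T. ereal (dx u x t)) \<le> ereal N"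
      using ux by (auto intro!: SUP_least)
    moreover have "ereal (1 / L / (A / L + t)) \<le> (INF x. ereal (rho \<tau> x t))"
      if t: "0 \<le> t" "ereal t < T" for t
    proof (rule INF_greatest)
      fix x
      have xt: "(x, t) \<in> strip T" using t by (simp add: strip_def)
      have "bdd_above (range \<tau>0)" using \<tau>_bdd \<tau>0 by (simp add: bounded_imp_bdd_above)
      then have "\<tau> x 0 \<le> A" using \<tau>0 unfolding A_def by (simp add: cSUP_upper max.coboundedI2)
      moreover have "L = M" using N0 by (simp add: L_def)
      moreover have "\<tau> x t \<le> \<tau> x 0 + M * t"
        using ux N0 by (intro tau_growth xt) (meson less_imp_le order_trans)
      ultimately have "\<tau> x t \<le> A + L * t" by simp
      then have "1 / (A + L * t) \<le> rho \<tau> x t"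
        unfolding rho_def using tau_pos[OF xt] by (intro divide_left_mono) auto
      moreover have "1 / L / (A / L + t) = 1 / (A + L * t)" using \<open>0 < L\<close> by (simp add: field_simps)
      ultimately show "ereal (1 / L / (A / L + t)) \<le> ereal (rho \<tau> x t)" by simp
    qed
    ultimately show "(SUP (x, t)\<in>strip T. ereal (max (?a x t) (?b x t))) < ereal M \<and>
      (SUP (x, t)\<in>strip T. ereal (dt \<tau> x t)) = (SUP (x, t)\<in>strip T. ereal (dx u x t)) \<and>
      (SUP (x, t)\<in>strip T. ereal (dx u x t)) < ereal M \<and>
      (\<forall>t. 0 \<le> t \<and> ereal t < T \<longrightarrow> ereal (1 / L / (A / L + t)) \<le> (INF x. ereal (rho \<tau> x t)))"
      using N(2) by (auto intro: le_less_trans)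
  qed
qed

end
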